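(* Let $a,b,n$ be positive integers with $ab \mid n$, and let $G = C(n;a,b)$ be the associated one-paired circulant graph. Then $G$ is isomorphic to \[\bigcup_{i=1}^a \left(\bigvee_{j=1}^{b} \overline{K_{\frac{n}{ab}}} \right),\] and $\alpha(G) = \frac{n}{b}$.
   Context: For an integer $n\ge 1$ and a set $S\subseteq\{1,\ldots,\lfloor n/2\rfloor\}$, the circulant graph $C_n(S)$ has vertex set $\{0,1,\ldots,n-1\}$, and distinct $x,y$ are adjacent if and only if $|x-y|\in S$ or $n-|x-y|\in S$. For positive integers $a,b$ with $ab\mid n$, the one-paired circulant $C(n;a,b)$ is the circulant graph $C_n(S)$ with $S=\{d\in\{1,\ldots,\lfloor n/2\rfloor\} : a\mid d \text{ and } ab\nmid d\}$. $\alpha(G)$ denotes the largest cardinality of an independent set of $G$. $\overline{K_m}$ is the graph on $m$ vertices with no edges. $\bigcup$ denotes disjoint union of graphs. The join $G\vee H$ of (vertex-disjoint) graphs has vertex set $V_G\cup V_H$ and edge set $E_G\cup E_H\cup\{\{x,y\} : x\in V_G, y\in V_H\}$; $\bigvee_{j=1}^b$ denotes the iterated join of $b$ disjoint copies. *)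

theory Defs
  imports Complex_Main "Graph_Theory.Graph_Theory"
begin

text \<open>
  Simple graphs are modelled as in \<^theory>\<open>Graph_Theory.Digraph\<close>: an undirected edge
  between \<open>x\<close> and \<open>y\<close> is the pair of arcs \<open>(x, y)\<close>, \<open>(y, x)\<close>, and
  \<^const>\<open>digraph_iso\<close> is then graph isomorphism.
\<close>

definition circulant :: "nat \<Rightarrow> nat set \<Rightarrow> nat pair_pre_digraph" where
  "circulant n S =
     \<lparr> pverts = {0..<n},
       parcs = {(x, y). x \<in> {0..<n} \<and> y \<in> {0..<n} \<and> x \<noteq> y \<and>
                 (nat \<bar>int x - int y\<bar> \<in> S \<or> n - nat \<bar>int x - int y\<bar> \<in> S)} \<rparr>"

lemma pair_graph_circulant: "pair_graph (circulant n S)"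
proof -
  have "finite (parcs (circulant n S))"
    by (rule finite_subset[of _ "{0..<n} \<times> {0..<n}"]) (auto simp: circulant_def)
  moreover have "sym (parcs (circulant n S))"
    by (auto simp: circulant_def sym_def abs_minus_commute)
  ultimately show ?thesis
    by unfold_locales (auto simp: circulant_def symmetric_def)
qed

definition one_paired_circulant :: "nat \<Rightarrow> nat \<Rightarrow> nat \<Rightarrow> nat pair_pre_digraph" where
  "one_paired_circulant n a b =
     circulant n {d \<in> {1..n div 2}. a dvd d \<and> \<not> a * b dvd d}"

definition edgeless_graph :: "nat \<Rightarrow> nat pair_pre_digraph" where
  "edgeless_graph m = \<lparr> pverts = {0..<m}, parcs = {} \<rparr>"

text \<open>Tagging every vertex with an index makes the members of a family vertex-disjoint.\<close>

definition tagged_copy :: "'i \<Rightarrow> 'a pair_pre_digraph \<Rightarrow> ('i \<times> 'a) pair_pre_digraph" where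
  "tagged_copy i G =
     \<lparr> pverts = Pair i ` pverts G, parcs = map_prod (Pair i) (Pair i) ` parcs G \<rparr>"

definition disjoint_union ::
    "'i set \<Rightarrow> ('i \<Rightarrow> 'a pair_pre_digraph) \<Rightarrow> ('i \<times> 'a) pair_pre_digraph" where
  "disjoint_union I G =
     \<lparr> pverts = (\<Union>i\<in>I. pverts (tagged_copy i (G i))),
       parcs = (\<Union>i\<in>I. parcs (tagged_copy i (G i))) \<rparr>"

text \<open>To be applied to vertex-disjoint graphs only.\<close>

definition graph_join ::
    "'a pair_pre_digraph \<Rightarrow> 'a pair_pre_digraph \<Rightarrow> 'a pair_pre_digraph" where
  "graph_join G H =
     \<lparr> pverts = pverts G \<union> pverts H,
       parcs = parcs G \<union> parcs H \<union> pverts G \<times> pverts H \<union> pverts H \<times> pverts G \<rparr>"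

text \<open>
  The join of disjoint copies of \<open>G 1, \<dots>, G b\<close>; the null graph, which is neutral for
  the join, serves as the case \<open>b = 0\<close>.
\<close>

primrec iterated_join ::
    "nat \<Rightarrow> (nat \<Rightarrow> 'a pair_pre_digraph) \<Rightarrow> (nat \<times> 'a) pair_pre_digraph" where
  "iterated_join 0 G = \<lparr> pverts = {}, parcs = {} \<rparr>"
| "iterated_join (Suc b) G = graph_join (iterated_join b G) (tagged_copy (Suc b) (G (Suc b)))"

definition independent_set :: "('a, 'b) pre_digraph \<Rightarrow> 'a set \<Rightarrow> bool" where
  "independent_set G A \<longleftrightarrow>
     A \<subseteq> verts G \<and> (\<forall>x\<in>A. \<forall>y\<in>A. (x, y) \<notin> arcs_ends G)"

text \<open>Meaningful for finite graphs, where the maximum is over a finite nonempty set.\<close>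

definition independence_number :: "('a, 'b) pre_digraph \<Rightarrow> nat" where
  "independence_number G = Max {card A | A. independent_set G A}"

end

theory Submission
  imports Defs
begin

text \<open>
  Since \<open>a * b\<close> divides \<open>n\<close>, replacing a distance \<open>d\<close> by \<open>n - d\<close> changes neither
  divisibility by \<open>a\<close> nor divisibility by \<open>a * b\<close>. The two-sided distance condition of the
  circulant graph therefore collapses to a pair of congruences: \<open>x\<close> and \<open>y\<close> are adjacent iff
  they are congruent modulo \<open>a\<close> but not modulo \<open>a * b\<close> (lemma \<open>one_paired_circulant_adjacent_iff\<close>).
  Write \<open>x = r + a * (s + b * q)\<close> with \<open>r < a\<close> and \<open>s < b\<close>, the mixed radix expansion
  of \<open>x\<close>. In these coordinates, adjacency means equal \<open>r\<close> and different \<open>s\<close>, while the digit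
  \<open>q\<close>, which takes \<open>n div (a * b)\<close> values, is unconstrained. This is the adjacency of a
  disjoint union (indexed by \<open>r\<close>) of joins (indexed by \<open>s\<close>) of edgeless graphs (on the
  values of \<open>q\<close>), so the expansion is the required isomorphism.

  In an independent set, equal \<open>r\<close> forces equal \<open>s\<close>; hence \<open>(r, q)\<close> determines the element
  and there are at most \<open>a * (n div (a * b)) = n div b\<close> of them. Choosing \<open>s = 0\<close> for every
  \<open>(r, q)\<close> attains the bound.
\<close>

section \<open>Isomorphisms of graphs given by pairs of vertices\<close>

text \<open>
  An isomorphism in the sense of the library consists of four functions. In a graph whose arcs
  are pairs, all of them are determined by the map on the vertices.
\<close>

lemma digraph_iso_with_projI:
  assumes bij: "bij_betw f (pverts G) (pverts H)"
    and wf_G: "pair_wf_digraph G" and wf_H: "pair_wf_digraph H"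
    and arcs: "\<And>x y. x \<in> pverts G \<Longrightarrow> y \<in> pverts G \<Longrightarrow>
                 (x, y) \<in> parcs G \<longleftrightarrow> (f x, f y) \<in> parcs H"
  shows "digraph_iso (with_proj G) (with_proj H)"
proof -
  let ?h = "\<lparr> iso_verts = f, iso_arcs = map_prod f f, iso_head = snd, iso_tail = fst \<rparr>"
  have sub: "parcs G \<subseteq> pverts G \<times> pverts G" "parcs H \<subseteq> pverts H \<times> pverts H"
    using wf_G wf_H by (auto simp: pair_wf_digraph_def)
  have inj: "inj_on f (pverts G)" and img: "f ` pverts G = pverts H"
    using bij by (auto simp: bij_betw_def)
  have "inj_on (map_prod f f) (parcs G)"
    by (rule inj_on_subset[OF map_prod_inj_on[OF inj inj] sub(1)])
  then have "pre_digraph.digraph_isomorphism (with_proj G) ?h"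
    using inj wf_G by (auto simp: pre_digraph.digraph_isomorphism_def wf_digraph_wp_iff)
  moreover have "map_prod f f ` parcs G = parcs H"
  proof
    show "map_prod f f ` parcs G \<subseteq> parcs H"
      using arcs sub(1) by auto
    show "parcs H \<subseteq> map_prod f f ` parcs G"
    proof
      fix e assume e: "e \<in> parcs H"
      then obtain x y where "x \<in> pverts G" "y \<in> pverts G" "e = (f x, f y)"
        using sub(2) img by blast
      with e arcs show "e \<in> map_prod f f ` parcs G" by force
    qed
  qed
  then have "with_proj H = app_iso ?h (with_proj G)"
    using img by (simp add: app_iso_def with_proj_def)
  ultimately show ?thesis unfolding digraph_iso_def by blast
qed

section \<open>The complete multipartite components\<close>

lemma pverts_iterated_join_edgeless:
  "pverts (iterated_join b (\<lambda>j. edgeless_graph m)) = {1..b} \<times> {0..<m}"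
proof (induction b)
  case (Suc b)
  have "{1..Suc b} = insert (Suc b) {1..b}" by auto
  with Suc show ?case
    by (auto simp: graph_join_def tagged_copy_def edgeless_graph_def)
qed simp

lemma parcs_iterated_join_edgeless_iff:
  "((j, k), (j', k')) \<in> parcs (iterated_join b (\<lambda>j. edgeless_graph m)) \<longleftrightarrow>
     j \<in> {1..b} \<and> j' \<in> {1..b} \<and> j \<noteq> j' \<and> k < m \<and> k' < m"
proof (induction b)
  case (Suc b)
  have "(j, k) \<in> pverts (tagged_copy (Suc b) (edgeless_graph m)) \<longleftrightarrow> j = Suc b \<and> k < m" for j k
    by (auto simp: tagged_copy_def edgeless_graph_def)
  moreover have "parcs (tagged_copy (Suc b) (edgeless_graph m)) = {}"
    by (simp add: tagged_copy_def edgeless_graph_def)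
  ultimately show ?case
    using Suc by (simp add: graph_join_def pverts_iterated_join_edgeless) linarith
qed simp

lemma pverts_disjoint_union_joins:
  "pverts (disjoint_union {1..a} (\<lambda>i. iterated_join b (\<lambda>j. edgeless_graph m))) =
     {1..a} \<times> {1..b} \<times> {0..<m}"
  by (auto simp: disjoint_union_def tagged_copy_def pverts_iterated_join_edgeless)

lemma parcs_disjoint_union_joins_iff:
  "((i, j, k), (i', j', k')) \<in>
       parcs (disjoint_union {1..a} (\<lambda>i. iterated_join b (\<lambda>j. edgeless_graph m))) \<longleftrightarrow>
     i \<in> {1..a} \<and> i = i' \<and> j \<in> {1..b} \<and> j' \<in> {1..b} \<and> j \<noteq> j' \<and> k < m \<and> k' < m"
proof -
  have "((i, j, k), (i', j', k')) \<in>
       parcs (disjoint_union {1..a} (\<lambda>i. iterated_join b (\<lambda>j. edgeless_graph m))) \<longleftrightarrow>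
     i \<in> {1..a} \<and> i = i' \<and>
       ((j, k), (j', k')) \<in> parcs (iterated_join b (\<lambda>j. edgeless_graph m))"
    by (force simp: disjoint_union_def tagged_copy_def)
  then show ?thesis by (simp only: parcs_iterated_join_edgeless_iff)
qed

section \<open>Adjacency by congruences\<close>

lemma dvd_nat_abs_diff_iff: "k dvd nat \<bar>int x - int y\<bar> \<longleftrightarrow> x mod k = y mod k"
proof -
  have "k dvd nat \<bar>int x - int y\<bar> \<longleftrightarrow> int k dvd int x - int y"
    by (simp add: nat_abs_dvd_iff flip: int_dvd_int_iff)
  also have "\<dots> \<longleftrightarrow> int x mod int k = int y mod int k"
    by (simp add: mod_eq_dvd_iff)
  finally show ?thesis by (simp flip: zmod_int)
qed

text \<open>
  One of \<open>d\<close> and \<open>n - d\<close> is at most \<open>n div 2\<close>, so the upper bound on the connection set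
  excludes no pair, and \<open>a * b dvd n\<close> makes the divisibility conditions for \<open>d\<close> and \<open>n - d\<close>
  equivalent.
\<close>

lemma one_paired_circulant_adjacent_iff:
  assumes "a * b dvd n" and "x < n" and "y < n"
  shows "(x, y) \<in> parcs (one_paired_circulant n a b) \<longleftrightarrow>
           x mod a = y mod a \<and> x mod (a * b) \<noteq> y mod (a * b)"
proof -
  define d where "d = nat \<bar>int x - int y\<bar>"
  define S where "S = {d \<in> {1..n div 2}. a dvd d \<and> \<not> a * b dvd d}"
  have d: "d < n" using assms(2,3) by (auto simp: d_def)
  have "a dvd n" using assms(1) by (rule dvd_mult_left)
  have "k dvd n - d \<longleftrightarrow> k dvd d" if "k dvd n" for k
    using that d by (metis dvd_diffD1 dvd_diff_nat less_imp_le_nat)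
  with \<open>a dvd n\<close> assms(1) have refl: "a dvd n - d \<longleftrightarrow> a dvd d" "a * b dvd n - d \<longleftrightarrow> a * b dvd d"
    by blast+
  have "(x, y) \<in> parcs (one_paired_circulant n a b) \<longleftrightarrow> x \<noteq> y \<and> (d \<in> S \<or> n - d \<in> S)"
    using assms(2,3) by (simp add: one_paired_circulant_def circulant_def d_def S_def)
  also have "\<dots> \<longleftrightarrow> a dvd d \<and> \<not> a * b dvd d"
  proof
    assume "x \<noteq> y \<and> (d \<in> S \<or> n - d \<in> S)"
    then show "a dvd d \<and> \<not> a * b dvd d" using refl by (auto simp: S_def)
  next
    assume *: "a dvd d \<and> \<not> a * b dvd d"
    then have "d \<noteq> 0" by (metis dvd_0_right)
    then have "x \<noteq> y" by (auto simp: d_def)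
    moreover have "d \<in> {1..n div 2} \<or> n - d \<in> {1..n div 2}"
      using d \<open>d \<noteq> 0\<close> by auto
    ultimately show "x \<noteq> y \<and> (d \<in> S \<or> n - d \<in> S)" using * refl by (auto simp: S_def)
  qed
  finally show ?thesis by (simp only: d_def dvd_nat_abs_diff_iff)
qed

section \<open>The isomorphism\<close>

text \<open>The digits are shifted by one where the index sets start at one.\<close>

definition mixed_radix_digits :: "nat \<Rightarrow> nat \<Rightarrow> nat \<Rightarrow> nat \<times> nat \<times> nat" where
  "mixed_radix_digits a b x = (x mod a + 1, x div a mod b + 1, x div (a * b))"

lemma bij_betw_mixed_radix_digits:
  assumes "a > 0" and "b > 0"
  shows "bij_betw (mixed_radix_digits a b) {0..<a * b * m} ({1..a} \<times> {1..b} \<times> {0..<m})"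
proof -
  let ?f = "mixed_radix_digits a b"
  have inj: "inj_on ?f {0..<a * b * m}"
  proof (rule inj_onI)
    fix x y assume "?f x = ?f y"
    then have "x mod (a * b) = y mod (a * b)" "x div (a * b) = y div (a * b)"
      by (simp_all add: mixed_radix_digits_def mod_mult2_eq)
    then show "x = y" by (metis div_mult_mod_eq)
  qed
  have sub: "?f ` {0..<a * b * m} \<subseteq> {1..a} \<times> {1..b} \<times> {0..<m}"
    using assms
    by (auto simp: mixed_radix_digits_def Suc_le_eq less_mult_imp_div_less mult.commute)
  have "?f ` {0..<a * b * m} = {1..a} \<times> {1..b} \<times> {0..<m}"
    using inj sub by (intro card_subset_eq) (simp_all add: card_image card_cartesian_product)
  with inj show ?thesis by (simp add: bij_betw_def)
qed

lemma one_paired_circulant_iso: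
  assumes "a > 0" and "b > 0" and "a * b dvd n"
  shows "digraph_iso (with_proj (one_paired_circulant n a b))
           (with_proj (disjoint_union {1..a}
              (\<lambda>i. iterated_join b (\<lambda>j. edgeless_graph (n div (a * b))))))"
proof (rule digraph_iso_with_projI)
  let ?G = "one_paired_circulant n a b"
  let ?H = "disjoint_union {1..a} (\<lambda>i. iterated_join b (\<lambda>j. edgeless_graph (n div (a * b))))"
  let ?f = "mixed_radix_digits a b"
  have verts: "pverts ?G = {0..<n}" by (simp add: one_paired_circulant_def circulant_def)
  have n: "a * b * (n div (a * b)) = n" using assms(3) by simp
  show bij: "bij_betw ?f (pverts ?G) (pverts ?H)"
    using bij_betw_mixed_radix_digits[OF assms(1,2), of "n div (a * b)"]
    by (simp only: n verts pverts_disjoint_union_joins)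
  show "pair_wf_digraph ?G"
    unfolding one_paired_circulant_def
    using pair_graph_circulant by (simp add: pair_graph_def pair_digraph_def pair_fin_digraph_def)
  show "pair_wf_digraph ?H"
    by unfold_locales (auto simp: pverts_disjoint_union_joins parcs_disjoint_union_joins_iff
        simp del: One_nat_def)
  fix x y assume xy: "x \<in> pverts ?G" "y \<in> pverts ?G"
  then have "?f x \<in> pverts ?H" "?f y \<in> pverts ?H"
    using bij by (auto simp: bij_betw_def)
  then have "(?f x, ?f y) \<in> parcs ?H \<longleftrightarrow>
      x mod a = y mod a \<and> x div a mod b \<noteq> y div a mod b"
    by (auto simp: pverts_disjoint_union_joins parcs_disjoint_union_joins_iff
        mixed_radix_digits_def simp del: One_nat_def)
  also have "\<dots> \<longleftrightarrow> x mod a = y mod a \<and> x mod (a * b) \<noteq> y mod (a * b)"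
    using assms(1) by (auto simp: mod_mult2_eq)
  also have "\<dots> \<longleftrightarrow> (x, y) \<in> parcs ?G"
    using xy assms(3) by (simp add: verts one_paired_circulant_adjacent_iff)
  finally show "(x, y) \<in> parcs ?G \<longleftrightarrow> (?f x, ?f y) \<in> parcs ?H" ..
qed

section \<open>The independence number\<close>

lemma independent_set_one_paired_circulant_iff:
  assumes "a * b dvd n"
  shows "independent_set (with_proj (one_paired_circulant n a b)) A \<longleftrightarrow>
           A \<subseteq> {0..<n} \<and> (\<forall>x\<in>A. \<forall>y\<in>A. x mod a = y mod a \<longrightarrow> x mod (a * b) = y mod (a * b))"
proof -
  have "pverts (one_paired_circulant n a b) = {0..<n}"
    by (simp add: one_paired_circulant_def circulant_def)
  moreover have "(x, y) \<notin> parcs (one_paired_circulant n a b) \<longleftrightarrow>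
      (x mod a = y mod a \<longrightarrow> x mod (a * b) = y mod (a * b))"
    if "A \<subseteq> {0..<n}" "x \<in> A" "y \<in> A" for x y
  proof -
    have "x < n" "y < n" using that by auto
    then show ?thesis by (simp only: one_paired_circulant_adjacent_iff[OF assms]) blast
  qed
  ultimately show ?thesis
    unfolding independent_set_def with_proj_simps by blast
qed

text \<open>
  The residue modulo \<open>a\<close> determines that modulo \<open>a * b\<close> within an independent set, so an
  element is pinned down by \<open>x mod a\<close> and \<open>x div (a * b)\<close>.
\<close>

lemma card_independent_set_le:
  assumes "a > 0" and "a * b dvd n"
    and indep: "independent_set (with_proj (one_paired_circulant n a b)) A"
  shows "card A \<le> a * (n div (a * b))"
proof -
  let ?g = "\<lambda>x. (x mod a, x div (a * b))"
  have A: "A \<subseteq> {0..<n}"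
    and mod_eq: "\<And>x y. x \<in> A \<Longrightarrow> y \<in> A \<Longrightarrow> x mod a = y mod a \<Longrightarrow> x mod (a * b) = y mod (a * b)"
    using indep unfolding independent_set_one_paired_circulant_iff[OF assms(2)] by blast+
  have "inj_on ?g A"
  proof (rule inj_onI)
    fix x y assume xy: "x \<in> A" "y \<in> A" and g: "?g x = ?g y"
    from g have "x mod a = y mod a" by blast
    with xy have "x mod (a * b) = y mod (a * b)" by (rule mod_eq)
    moreover from g have "x div (a * b) = y div (a * b)" by blast
    ultimately show "x = y" by (metis div_mult_mod_eq)
  qed
  moreover have "?g ` A \<subseteq> {0..<a} \<times> {0..<n div (a * b)}"
  proof -
    have "x div (a * b) < n div (a * b)" if "x \<in> A" for x
      using that A assms(2) by (intro less_mult_imp_div_less) auto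
    then show ?thesis using assms(1) by auto
  qed
  ultimately have "card A \<le> card ({0..<a} \<times> {0..<n div (a * b)})"
    by (intro card_inj_on_le) auto
  then show ?thesis by (simp add: card_cartesian_product)
qed

text \<open>The extremal set consists of the vertices whose middle mixed radix digit is zero.\<close>

lemma independent_set_attaining_bound:
  assumes "a > 0" and "b > 0" and "a * b dvd n"
  obtains A where "independent_set (with_proj (one_paired_circulant n a b)) A"
    and "card A = a * (n div (a * b))"
proof
  let ?m = "n div (a * b)"
  let ?g = "\<lambda>(r, q). r + a * b * q"
  let ?D = "{0..<a} \<times> {0..<?m}"
  have less: "r < a * b" if "r < a" for r
  proof -
    have "a \<le> a * b" using assms(2) by simp
    with that show ?thesis by (rule less_le_trans)
  qed
  have "inj_on ?g ?D"
  proof (rule inj_onI, clarify)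
    fix r q r' q' assume *: "r \<in> {0..<a}" "r' \<in> {0..<a}" "r + a * b * q = r' + a * b * q'"
    from *(3) have "(r + a * b * q) mod (a * b) = (r' + a * b * q') mod (a * b)" by (rule arg_cong)
    moreover have "r < a * b" "r' < a * b" using * less by auto
    ultimately have "r = r'" by (simp only: mod_mult_self2 mod_less)
    then show "r = r' \<and> q = q'" using * assms(1,2) by simp
  qed
  then show "card (?g ` ?D) = a * ?m"
    by (simp add: card_image card_cartesian_product)
  have "r + a * b * q < n" if "r < a" "q < ?m" for r q
  proof -
    have "r + a * b * q < a * b + a * b * q" using less[OF that(1)] by simp
    also have "\<dots> = a * b * Suc q" by simp
    also have "\<dots> \<le> a * b * ?m" using that(2) by (intro mult_le_mono2) simp
    also have "\<dots> = n" using assms(3) by simp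
    finally show ?thesis .
  qed
  moreover have "(r + a * b * q) mod a = r" if "r < a" for r q
    using that by (simp add: mult.assoc)
  ultimately show "independent_set (with_proj (one_paired_circulant n a b)) (?g ` ?D)"
    by (auto simp: independent_set_one_paired_circulant_iff[OF assms(3)])
qed

lemma independence_number_one_paired_circulant:
  assumes "a > 0" and "b > 0" and "a * b dvd n"
  shows "independence_number (with_proj (one_paired_circulant n a b)) = a * (n div (a * b))"
proof -
  let ?C = "{card A | A. independent_set (with_proj (one_paired_circulant n a b)) A}"
  have bound: "c \<le> a * (n div (a * b))" if "c \<in> ?C" for c
    using that card_independent_set_le[OF assms(1,3)] by auto
  then have fin: "finite ?C" by (meson finite_nat_set_iff_bounded_le)
  obtain A where A: "independent_set (with_proj (one_paired_circulant n a b)) A"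
    and card_A: "card A = a * (n div (a * b))"
    by (rule independent_set_attaining_bound[OF assms])
  have mem: "a * (n div (a * b)) \<in> ?C"
    unfolding card_A[symmetric] using A by blast
  show ?thesis
    unfolding independence_number_def using fin bound mem by (rule Max_eqI)
qed

section \<open>Structure and independence number of one-paired circulants\<close>

theorem theorem5p4:
  fixes a b n :: nat
  assumes "a > 0" and "b > 0" and "n > 0" and "a * b dvd n"
  shows "digraph_iso (with_proj (one_paired_circulant n a b))
           (with_proj (disjoint_union {1..a}
              (\<lambda>i. iterated_join b (\<lambda>j. edgeless_graph (n div (a * b))))))
       \<and> real (independence_number (with_proj (one_paired_circulant n a b))) = real n / real b"
proof
  show "digraph_iso (with_proj (one_paired_circulant n a b))
          (with_proj (disjoint_union {1..a}
             (\<lambda>i. iterated_join b (\<lambda>j. edgeless_graph (n div (a * b))))))"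
    using assms by (intro one_paired_circulant_iso)
  obtain m where n: "n = a * b * m" using assms(4) ..
  with assms have "independence_number (with_proj (one_paired_circulant n a b)) = a * m"
    by (simp add: independence_number_one_paired_circulant)
  with n assms(2)
  show "real (independence_number (with_proj (one_paired_circulant n a b))) = real n / real b"
    by simp
qed

end
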